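(* Let $\mathbb{K}$ be $\mathbb{R}$ or $\mathbb{C}$, and let $X$ be a topological exponential vector space over $\mathbb{K}$ with additive identity $\theta$. Then there exists a local base $\mathscr{U}$ at $\theta$ such that the following conditions hold: (i) every $U\in\mathscr{U}$ is balanced and absorbing; (ii) for every $U\in\mathscr{U}$ there exists $V\in\mathscr{U}$ such that $V+V\subseteq U$; (iii) for all $U_1,U_2\in\mathscr{U}$ there exists $W\in\mathscr{U}$ such that $W\subseteq U_1\cap U_2$; (iv) for any $x,y\in X$ with $x\nleq y$ there exist $U,V\in\mathscr{U}$ such that $\uparrow(x+U)\,\cap\downarrow(y+V)=\emptyset$; (v) for any $x\in X$, any open set $G$ containing $x$ and any $\alpha\in\mathbb{K}\smallsetminus\{0\}$, there exist $U_x\in\mathscr{U}$ and $\epsilon>0$ such that $B(\alpha,\epsilon)\cdot(x+U_x)\subseteq\alpha G$, where $B(\alpha,\epsilon):=\{\lambda\in\mathbb{K}:|\alpha-\lambda|<\epsilon\}$.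
   Context: An exponential vector space (evs) over a field $K$ is a partially ordered set $(X,\leq)$ with a binary operation $+$ on $X$ and a scalar multiplication $\cdot:K\times X\to X$ such that for all $x,y,z\in X$, $\alpha,\beta\in K$: ($A_1$) $(X,+)$ is a commutative semigroup with identity $\theta$; ($A_2$) $x\leq y$ implies $x+z\leq y+z$ and $\alpha\cdot x\leq\alpha\cdot y$; ($A_3$) $\alpha\cdot(x+y)=\alpha\cdot x+\alpha\cdot y$, $\alpha\cdot(\beta\cdot x)=(\alpha\beta)\cdot x$, $(\alpha+\beta)\cdot x\leq\alpha\cdot x+\beta\cdot x$, $1\cdot x=x$; ($A_4$) $\alpha\cdot x=\theta$ iff $\alpha=0$ or $x=\theta$; ($A_5$) $x+(-1)\cdot x=\theta$ iff $x\in X_0:=\{z\in X: y\nleq z\ \forall y\in X\smallsetminus\{z\}\}$ (the set of minimal elements); ($A_6$) for each $x\in X$ there is $p\in X_0$ with $p\leq x$. A topological evs over $\mathbb{K}$ ($=\mathbb{R}$ or $\mathbb{C}$, usual topology) is an evs $X$ over $\mathbb{K}$ with a topology such that addition $X\times X\to X$ and scalar multiplication $\mathbb{K}\times X\to X$ are continuous and the partial order is closed, i.e. $\{(x,y)\in X\times X:x\leq y\}$ is closed in $X\times X$. A set $A\subseteq X$ is absorbing if for every $x\in X$ there is a real $\alpha>0$ such that $\mu x\in A$ for all $\mu\in\mathbb{K}$ with $|\mu|\leq\alpha$. It is balanced if $\alpha A\subseteq A$ for all $\alpha\in\mathbb{K}$ with $|\alpha|\leq1$. For $A,B\subseteq X$,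 $\alpha\in\mathbb{K}$, $S\subseteq\mathbb{K}$, $x\in X$: $A+B=\{a+b:a\in A,b\in B\}$, $x+A=\{x+a:a\in A\}$, $\alpha A=\{\alpha a:a\in A\}$, $S\cdot A=\{\lambda a:\lambda\in S,a\in A\}$, $\uparrow A=\{x\in X:x\geq a\text{ for some }a\in A\}$, $\downarrow A=\{x\in X:x\leq a\text{ for some }a\in A\}$. Neighbourhoods of a point are sets containing an open set containing the point (not necessarily open); a local base at a point is a family of neighbourhoods of that point such that every neighbourhood of the point contains a member of the family. *)

theory Defs
  imports "HOL-Analysis.Analysis" "HOL-Library.Set_Algebras"
begin

text \<open>
  The space is a type, as in \<^locale>\<open>vector_space\<close>. Addition, its identity \<open>\<theta>\<close> (written \<open>0\<close>)
  and the partial order come from the class \<^class>\<open>ordered_comm_monoid_add\<close>, which supplies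
  axiom A1 and the additive half of A2; only the scalar multiplication is an explicit parameter.
\<close>

definition minimal_points :: "'x::order set"
  where "minimal_points = {z. \<forall>y\<in>UNIV - {z}. \<not> y \<le> z}"

locale evs =
  fixes smul :: "'k::field \<Rightarrow> 'x::ordered_comm_monoid_add \<Rightarrow> 'x"
  assumes smul_mono: "x \<le> y \<Longrightarrow> smul \<alpha> x \<le> smul \<alpha> y"
    and smul_add_right: "smul \<alpha> (x + y) = smul \<alpha> x + smul \<alpha> y"
    and smul_smul: "smul \<alpha> (smul \<beta> x) = smul (\<alpha> * \<beta>) x"
    and smul_add_left_le: "smul (\<alpha> + \<beta>) x \<le> smul \<alpha> x + smul \<beta> x"
    and smul_one: "smul 1 x = x"
    and smul_eq_0_iff: "smul \<alpha> x = 0 \<longleftrightarrow> \<alpha> = 0 \<or> x = 0"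
    and add_smul_minus_one_eq_0_iff: "x + smul (- 1) x = 0 \<longleftrightarrow> x \<in> minimal_points"
    and ex_minimal_le: "\<exists>p\<in>minimal_points. p \<le> x"

text \<open>The scalar type is meant to be \<^typ>\<open>real\<close> or \<^typ>\<open>complex\<close>.\<close>

locale topological_evs = evs smul
  for smul :: "'k::real_normed_field \<Rightarrow> 'x::{ordered_comm_monoid_add, topological_space} \<Rightarrow> 'x" +
  assumes continuous_add: "continuous_on UNIV (\<lambda>(x :: 'x, y). x + y)"
    and continuous_smul: "continuous_on UNIV (\<lambda>(\<alpha>, x). smul \<alpha> x)"
    and closed_order: "closed {(x :: 'x, y). x \<le> y}"

definition absorbing :: "('k::real_normed_field \<Rightarrow> 'x \<Rightarrow> 'x) \<Rightarrow> 'x set \<Rightarrow> bool"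
  where "absorbing smul A \<longleftrightarrow>
    (\<forall>x. \<exists>\<alpha>::real. \<alpha> > 0 \<and> (\<forall>\<mu>. norm \<mu> \<le> \<alpha> \<longrightarrow> smul \<mu> x \<in> A))"

definition balanced :: "('k::real_normed_field \<Rightarrow> 'x \<Rightarrow> 'x) \<Rightarrow> 'x set \<Rightarrow> bool"
  where "balanced smul A \<longleftrightarrow> (\<forall>\<alpha>. norm \<alpha> \<le> 1 \<longrightarrow> smul \<alpha> ` A \<subseteq> A)"

definition smul_sets :: "('k \<Rightarrow> 'x \<Rightarrow> 'x) \<Rightarrow> 'k set \<Rightarrow> 'x set \<Rightarrow> 'x set"
  where "smul_sets smul S A = {smul \<alpha> a | \<alpha> a. \<alpha> \<in> S \<and> a \<in> A}"

definition up_set :: "'x::order set \<Rightarrow> 'x set"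
  where "up_set A = {x. \<exists>a\<in>A. a \<le> x}"

definition down_set :: "'x::order set \<Rightarrow> 'x set"
  where "down_set A = {x. \<exists>a\<in>A. x \<le> a}"

definition neighbourhood :: "'x::topological_space \<Rightarrow> 'x set \<Rightarrow> bool"
  where "neighbourhood x N \<longleftrightarrow> (\<exists>S. open S \<and> x \<in> S \<and> S \<subseteq> N)"

definition local_base :: "'x::topological_space \<Rightarrow> 'x set set \<Rightarrow> bool"
  where "local_base x \<U> \<longleftrightarrow>
    (\<forall>U\<in>\<U>. neighbourhood x U) \<and> (\<forall>N. neighbourhood x N \<longrightarrow> (\<exists>U\<in>\<U>. U \<subseteq> N))"

end

theory Submission
  imports Defs
begin

text \<open>
  The balanced neighbourhoods of \<open>\<theta>\<close> serve as the local base, exactly as in a topological vector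
  space. The usual argument survives because it uses inverses of scalars but never an additive
  inverse of a vector. Joint continuity of the scalar multiplication at \<open>(0, \<theta>)\<close> gives a radius
  \<open>\<epsilon>\<close> and an open \<open>V\<close> around \<open>\<theta>\<close> such that \<open>B(0, \<epsilon>) \<cdot> V\<close> lies in a prescribed neighbourhood.
  This product is balanced, and it is a neighbourhood of \<open>\<theta>\<close> because scaling by a nonzero scalar is a
  homeomorphism (lemma \<open>balanced_nbhd_subset\<close>). So the balanced neighbourhoods do form a base.

  The remaining conditions come from this base by continuity. Neighbourhoods of a point \<open>x\<close> are in
  general not translates of neighbourhoods of \<open>\<theta>\<close>, since translations need not be invertible; but
  \<open>u \<mapsto> x + u\<close> is continuous, so every neighbourhood of \<open>x\<close> contains some \<open>x + U\<close> (lemma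
  \<open>translate_subset\<close>). With this half of translation invariance, closedness of the order separates
  \<open>x\<close> and \<open>y\<close> when \<open>x \<le> y\<close> fails, and continuity of the scalar multiplication at \<open>(1, x)\<close> gives the
  condition on \<open>B(\<alpha>, \<epsilon>) \<cdot> (x + U)\<close>.
\<close>

context topological_evs
begin

lemma smul_zero_left: "smul 0 x = 0"
  by (simp add: smul_eq_0_iff)

lemma smul_zero_right: "smul \<alpha> 0 = 0"
  by (simp add: smul_eq_0_iff)

lemma continuous_on_translation: "continuous_on UNIV (\<lambda>u :: 'x. x + u)"
proof -
  have "continuous_on UNIV ((\<lambda>(x :: 'x, y). x + y) \<circ> (\<lambda>u. (x, u)))"
    by (intro continuous_on_compose continuous_intros continuous_on_subset[OF continuous_add]) auto
  then show ?thesis by (simp add: o_def)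
qed

lemma continuous_on_smul_right: "continuous_on UNIV (smul \<alpha>)"
proof -
  have "continuous_on UNIV ((\<lambda>(\<alpha>, x). smul \<alpha> x) \<circ> (\<lambda>x. (\<alpha>, x)))"
    by (intro continuous_on_compose continuous_intros continuous_on_subset[OF continuous_smul]) auto
  then show ?thesis by (simp add: o_def)
qed

text \<open>Scaling by the inverse scalar is a continuous inverse of \<open>smul \<alpha>\<close>.\<close>

lemma open_smul_image:
  assumes "\<alpha> \<noteq> 0" "open G"
  shows "open (smul \<alpha> ` G)"
proof -
  have "smul \<alpha> ` G = smul (inverse \<alpha>) -` G"
  proof (intro equalityI subsetI)
    fix y assume "y \<in> smul (inverse \<alpha>) -` G"
    moreover have "y = smul \<alpha> (smul (inverse \<alpha>) y)"
      using \<open>\<alpha> \<noteq> 0\<close> by (simp add: smul_smul smul_one)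
    ultimately show "y \<in> smul \<alpha> ` G" by blast
  qed (use \<open>\<alpha> \<noteq> 0\<close> in \<open>auto simp: smul_smul smul_one\<close>)
  then show ?thesis
    using open_vimage[OF \<open>open G\<close> continuous_on_smul_right] by simp
qed

lemma smul_continuity_nbhd:
  assumes "open G" "smul \<alpha> x \<in> G"
  obtains \<epsilon> V where "\<epsilon> > 0" "open V" "x \<in> V"
    "\<And>\<mu> v. \<mu> \<in> ball \<alpha> \<epsilon> \<Longrightarrow> v \<in> V \<Longrightarrow> smul \<mu> v \<in> G"
proof -
  have "open ((\<lambda>(\<alpha>, x). smul \<alpha> x) -` G)"
    using assms(1) continuous_smul by (rule open_vimage)
  moreover have "(\<alpha>, x) \<in> (\<lambda>(\<alpha>, x). smul \<alpha> x) -` G"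
    using assms(2) by simp
  ultimately obtain S V where SV: "open S" "open V" "(\<alpha>, x) \<in> S \<times> V"
      "S \<times> V \<subseteq> (\<lambda>(\<alpha>, x). smul \<alpha> x) -` G"
    by (rule open_prod_elim)
  then obtain \<epsilon> where "\<epsilon> > 0" "ball \<alpha> \<epsilon> \<subseteq> S"
    by (auto simp: open_contains_ball)
  moreover have "smul \<mu> v \<in> G" if "\<mu> \<in> ball \<alpha> \<epsilon>" "v \<in> V" for \<mu> v
    using subsetD[OF SV(4), of "(\<mu>, v)"] subsetD[OF \<open>ball \<alpha> \<epsilon> \<subseteq> S\<close>] that by simp
  ultimately show thesis using SV(2,3) by (intro that[of \<epsilon> V]) auto
qed

definition balanced_nbhds :: "'x set set"
  where "balanced_nbhds = {U. neighbourhood 0 U \<and> balanced smul U}"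

lemma balanced_nbhd_subset:
  assumes "open S" "0 \<in> S"
  obtains U where "U \<in> balanced_nbhds" "U \<subseteq> S"
proof -
  have "smul 0 0 \<in> S" using assms(2) by (simp add: smul_zero_left)
  then obtain \<epsilon> V where V: "\<epsilon> > 0" "open V" "0 \<in> V"
      "\<And>\<mu> v. \<mu> \<in> ball 0 \<epsilon> \<Longrightarrow> v \<in> V \<Longrightarrow> smul \<mu> v \<in> S"
    using smul_continuity_nbhd[OF assms(1)] by metis
  define U where "U = smul_sets smul (ball 0 \<epsilon>) V"
  have "balanced smul U"
    unfolding balanced_def
  proof (intro allI impI subsetI)
    fix \<alpha> :: 'k and y assume \<alpha>: "norm \<alpha> \<le> 1" and "y \<in> smul \<alpha> ` U"
    then obtain \<mu> v where y: "y = smul (\<alpha> * \<mu>) v" and \<mu>: "norm \<mu> < \<epsilon>" and v: "v \<in> V"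
      by (auto simp: U_def smul_sets_def smul_smul)
    have "norm (\<alpha> * \<mu>) \<le> norm \<mu>"
      using mult_right_mono[OF \<alpha>, of "norm \<mu>"] by (simp add: norm_mult)
    with \<mu> have "\<alpha> * \<mu> \<in> ball 0 \<epsilon>" by simp
    with y v show "y \<in> U" by (auto simp: U_def smul_sets_def)
  qed
  moreover have "neighbourhood 0 U"
  proof -
    define c :: 'k where "c = of_real (\<epsilon> / 2)"
    have c: "c \<noteq> 0" "c \<in> ball 0 \<epsilon>"
      using V(1) by (auto simp: c_def)
    have "open (smul c ` V)"
      using c(1) V(2) by (rule open_smul_image)
    moreover have "0 \<in> smul c ` V"
      using V(3) smul_zero_right[of c] by force
    moreover have "smul c ` V \<subseteq> U"
      using c(2) by (auto simp: U_def smul_sets_def)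
    ultimately show ?thesis unfolding neighbourhood_def by blast
  qed
  moreover have "U \<subseteq> S"
    using V(4) by (auto simp: U_def smul_sets_def)
  ultimately show thesis by (intro that[of U]) (auto simp: balanced_nbhds_def)
qed

lemma local_base_balanced_nbhds: "local_base 0 balanced_nbhds"
proof -
  have "\<exists>U\<in>balanced_nbhds. U \<subseteq> N" if "neighbourhood 0 N" for N
    using that balanced_nbhd_subset unfolding neighbourhood_def by (metis subset_trans)
  then show ?thesis by (auto simp: local_base_def balanced_nbhds_def)
qed

text \<open>For fixed \<open>x\<close> the map \<open>\<mu> \<mapsto> \<mu> x\<close> is continuous and sends \<open>0\<close> to \<open>\<theta>\<close>.\<close>

lemma absorbing_neighbourhood:
  assumes "neighbourhood 0 U"
  shows "absorbing smul U"
  unfolding absorbing_def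
proof
  fix x
  obtain S where S: "open S" "0 \<in> S" "S \<subseteq> U"
    using assms by (auto simp: neighbourhood_def)
  have "smul 0 x \<in> S" using S(2) by (simp add: smul_zero_left)
  then obtain \<epsilon> V where V: "\<epsilon> > 0" "x \<in> V"
      "\<And>\<mu> v. \<mu> \<in> ball 0 \<epsilon> \<Longrightarrow> v \<in> V \<Longrightarrow> smul \<mu> v \<in> S"
    using smul_continuity_nbhd[OF S(1)] by metis
  have "smul \<mu> x \<in> U" if "norm \<mu> \<le> \<epsilon> / 2" for \<mu>
    using V(1) V(3)[of \<mu> x] V(2) S(3) that by auto
  with V(1) show "\<exists>\<alpha>>0. \<forall>\<mu>. norm \<mu> \<le> \<alpha> \<longrightarrow> smul \<mu> x \<in> U"
    by (intro exI[of _ "\<epsilon> / 2"]) auto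
qed

lemma balanced_nbhds_Int:
  assumes "U\<^sub>1 \<in> balanced_nbhds" "U\<^sub>2 \<in> balanced_nbhds"
  shows "U\<^sub>1 \<inter> U\<^sub>2 \<in> balanced_nbhds"
proof -
  obtain S\<^sub>1 S\<^sub>2 where "open S\<^sub>1" "0 \<in> S\<^sub>1" "S\<^sub>1 \<subseteq> U\<^sub>1" "open S\<^sub>2" "0 \<in> S\<^sub>2" "S\<^sub>2 \<subseteq> U\<^sub>2"
    using assms by (auto simp: balanced_nbhds_def neighbourhood_def)
  then have "neighbourhood 0 (U\<^sub>1 \<inter> U\<^sub>2)"
    unfolding neighbourhood_def by (intro exI[of _ "S\<^sub>1 \<inter> S\<^sub>2"]) auto
  then show ?thesis
    using assms by (fastforce simp: balanced_nbhds_def balanced_def)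
qed

lemma balanced_nbhds_halve:
  assumes "U \<in> balanced_nbhds"
  shows "\<exists>V\<in>balanced_nbhds. V + V \<subseteq> U"
proof -
  obtain S where S: "open S" "0 \<in> S" "S \<subseteq> U"
    using assms by (auto simp: balanced_nbhds_def neighbourhood_def)
  have "open ((\<lambda>(x, y). x + y) -` S)"
    using S(1) continuous_add by (rule open_vimage)
  moreover have "(0, 0) \<in> (\<lambda>(x, y). x + y) -` S"
    using S(2) by simp
  ultimately obtain A B where AB: "open A" "open B" "(0, 0) \<in> A \<times> B"
      "A \<times> B \<subseteq> (\<lambda>(x, y). x + y) -` S"
    by (rule open_prod_elim)
  then have "open (A \<inter> B)" "0 \<in> A \<inter> B" by auto
  then obtain V where "V \<in> balanced_nbhds" "V \<subseteq> A \<inter> B"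
    by (rule balanced_nbhd_subset)
  moreover have "a + b \<in> U" if "a \<in> V" "b \<in> V" for a b
    using subsetD[OF AB(4), of "(a, b)"] S(3) \<open>V \<subseteq> A \<inter> B\<close> that by auto
  ultimately show ?thesis
    by (intro bexI[of _ V]) (auto simp: set_plus_def)
qed

lemma translate_subset:
  assumes "open G" "x \<in> G"
  obtains U where "U \<in> balanced_nbhds" "x +o U \<subseteq> G"
proof -
  have "open ((\<lambda>u. x + u) -` G)"
    using assms(1) continuous_on_translation by (rule open_vimage)
  moreover have "0 \<in> (\<lambda>u. x + u) -` G" using assms(2) by simp
  ultimately obtain U where "U \<in> balanced_nbhds" "U \<subseteq> (\<lambda>u. x + u) -` G"
    by (rule balanced_nbhd_subset)
  then show thesis by (intro that[of U]) (auto simp: elt_set_plus_def)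
qed

text \<open>
  Closedness of the order gives neighbourhoods \<open>A\<close> of \<open>x\<close> and \<open>B\<close> of \<open>y\<close> such that no point of \<open>A\<close> is
  below a point of \<open>B\<close>. A common point of \<open>\<up>A\<close> and \<open>\<down>B\<close> would, by transitivity, produce such a pair.
\<close>

lemma order_separation:
  assumes "\<not> x \<le> y"
  shows "\<exists>U\<in>balanced_nbhds. \<exists>V\<in>balanced_nbhds. up_set (x +o U) \<inter> down_set (y +o V) = {}"
proof -
  have "open (- {(x :: 'x, y). x \<le> y})" using closed_order by (rule open_Compl)
  moreover have "(x, y) \<in> - {(x, y). x \<le> y}" using assms by simp
  ultimately obtain A B where AB: "open A" "open B" "(x, y) \<in> A \<times> B"
      "A \<times> B \<subseteq> - {(x, y). x \<le> y}"
    by (rule open_prod_elim)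
  obtain U where U: "U \<in> balanced_nbhds" "x +o U \<subseteq> A"
    using translate_subset[OF AB(1)] AB(3) by blast
  obtain V where V: "V \<in> balanced_nbhds" "y +o V \<subseteq> B"
    using translate_subset[OF AB(2)] AB(3) by blast
  have "\<not> a \<le> b" if "a \<in> x +o U" "b \<in> y +o V" for a b
    using that U(2) V(2) AB(4) by auto
  then have "up_set (x +o U) \<inter> down_set (y +o V) = {}"
    unfolding up_set_def down_set_def by (blast intro: order_trans)
  with U(1) V(1) show ?thesis by blast
qed

text \<open>
  Since \<open>\<lambda> z = \<alpha> ((\<lambda> / \<alpha>) z)\<close>, it suffices that \<open>(\<lambda> / \<alpha>) z\<close> lies in \<open>G\<close>; this holds for \<open>\<lambda> / \<alpha>\<close>
  near \<open>1\<close> and \<open>z\<close> near \<open>x\<close>, by continuity.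
\<close>

lemma ball_smul_translate_subset:
  assumes "open G" "x \<in> G" "\<alpha> \<noteq> 0"
  shows "\<exists>U\<in>balanced_nbhds. \<exists>\<epsilon>>0. smul_sets smul (ball \<alpha> \<epsilon>) (x +o U) \<subseteq> smul \<alpha> ` G"
proof -
  have "smul 1 x \<in> G" using assms(2) by (simp add: smul_one)
  then obtain \<delta> V where V: "\<delta> > 0" "open V" "x \<in> V"
      "\<And>\<mu> v. \<mu> \<in> ball 1 \<delta> \<Longrightarrow> v \<in> V \<Longrightarrow> smul \<mu> v \<in> G"
    using smul_continuity_nbhd[OF assms(1)] by metis
  obtain U where U: "U \<in> balanced_nbhds" "x +o U \<subseteq> V"
    using translate_subset[OF V(2,3)] .
  define \<epsilon> where "\<epsilon> = \<delta> * norm \<alpha>"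
  have "\<epsilon> > 0" using V(1) assms(3) by (simp add: \<epsilon>_def)
  moreover have "smul \<mu> z \<in> smul \<alpha> ` G" if "\<mu> \<in> ball \<alpha> \<epsilon>" "z \<in> x +o U" for \<mu> z
  proof -
    have "dist 1 (\<mu> / \<alpha>) = dist \<alpha> \<mu> / norm \<alpha>"
      using assms(3) by (simp add: dist_norm flip: norm_divide) (simp add: diff_divide_distrib)
    also have "\<dots> < \<delta>"
      using that(1) assms(3) by (simp add: \<epsilon>_def pos_divide_less_eq)
    finally have "smul (\<mu> / \<alpha>) z \<in> G"
      using V(4) U(2) that(2) by auto
    moreover have "smul \<mu> z = smul \<alpha> (smul (\<mu> / \<alpha>) z)"
      using assms(3) by (simp add: smul_smul)
    ultimately show ?thesis by blast
  qed
  then have "smul_sets smul (ball \<alpha> \<epsilon>) (x +o U) \<subseteq> smul \<alpha> ` G"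
    unfolding smul_sets_def by blast
  ultimately show ?thesis using U(1) by blast
qed

theorem ex_local_base:
  "\<exists>\<U>. local_base 0 \<U> \<and>
    (\<forall>U\<in>\<U>. balanced smul U \<and> absorbing smul U) \<and>
    (\<forall>U\<in>\<U>. \<exists>V\<in>\<U>. V + V \<subseteq> U) \<and>
    (\<forall>U\<^sub>1\<in>\<U>. \<forall>U\<^sub>2\<in>\<U>. \<exists>W\<in>\<U>. W \<subseteq> U\<^sub>1 \<inter> U\<^sub>2) \<and>
    (\<forall>x y. \<not> x \<le> y \<longrightarrow>
      (\<exists>U\<in>\<U>. \<exists>V\<in>\<U>. up_set (x +o U) \<inter> down_set (y +o V) = {})) \<and>
    (\<forall>x G \<alpha>. open G \<and> x \<in> G \<and> \<alpha> \<noteq> 0 \<longrightarrow>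
      (\<exists>U\<in>\<U>. \<exists>\<epsilon>>0. smul_sets smul (ball \<alpha> \<epsilon>) (x +o U) \<subseteq> smul \<alpha> ` G))"
proof (intro exI[of _ balanced_nbhds] conjI ballI allI impI)
  fix U assume "U \<in> balanced_nbhds"
  then show "balanced smul U" "absorbing smul U"
    by (auto simp: balanced_nbhds_def absorbing_neighbourhood)
next
  fix U\<^sub>1 U\<^sub>2 assume "U\<^sub>1 \<in> balanced_nbhds" "U\<^sub>2 \<in> balanced_nbhds"
  then show "\<exists>W\<in>balanced_nbhds. W \<subseteq> U\<^sub>1 \<inter> U\<^sub>2"
    using balanced_nbhds_Int by blast
qed (simp_all add: local_base_balanced_nbhds balanced_nbhds_halve order_separation
    ball_smul_translate_subset)

end

theorem theorem4p6:
  fixes smulR :: "real \<Rightarrow> 'x::{ordered_comm_monoid_add, topological_space} \<Rightarrow> 'x"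
    and smulC :: "complex \<Rightarrow> 'y::{ordered_comm_monoid_add, topological_space} \<Rightarrow> 'y"
  shows "(topological_evs smulR \<longrightarrow>
      (\<exists>\<U>. local_base 0 \<U> \<and>
        (\<forall>U\<in>\<U>. balanced smulR U \<and> absorbing smulR U) \<and>
        (\<forall>U\<in>\<U>. \<exists>V\<in>\<U>. V + V \<subseteq> U) \<and>
        (\<forall>U\<^sub>1\<in>\<U>. \<forall>U\<^sub>2\<in>\<U>. \<exists>W\<in>\<U>. W \<subseteq> U\<^sub>1 \<inter> U\<^sub>2) \<and>
        (\<forall>x y. \<not> x \<le> y \<longrightarrow>
          (\<exists>U\<in>\<U>. \<exists>V\<in>\<U>. up_set (x +o U) \<inter> down_set (y +o V) = {})) \<and>
        (\<forall>x G \<alpha>. open G \<and> x \<in> G \<and> \<alpha> \<noteq> 0 \<longrightarrow>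
          (\<exists>U\<in>\<U>. \<exists>\<epsilon>>0. smul_sets smulR (ball \<alpha> \<epsilon>) (x +o U) \<subseteq> smulR \<alpha> ` G)))) \<and>
    (topological_evs smulC \<longrightarrow>
      (\<exists>\<U>. local_base 0 \<U> \<and>
        (\<forall>U\<in>\<U>. balanced smulC U \<and> absorbing smulC U) \<and>
        (\<forall>U\<in>\<U>. \<exists>V\<in>\<U>. V + V \<subseteq> U) \<and>
        (\<forall>U\<^sub>1\<in>\<U>. \<forall>U\<^sub>2\<in>\<U>. \<exists>W\<in>\<U>. W \<subseteq> U\<^sub>1 \<inter> U\<^sub>2) \<and>
        (\<forall>x y. \<not> x \<le> y \<longrightarrow>
          (\<exists>U\<in>\<U>. \<exists>V\<in>\<U>. up_set (x +o U) \<inter> down_set (y +o V) = {})) \<and>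
        (\<forall>x G \<alpha>. open G \<and> x \<in> G \<and> \<alpha> \<noteq> 0 \<longrightarrow>
          (\<exists>U\<in>\<U>. \<exists>\<epsilon>>0. smul_sets smulC (ball \<alpha> \<epsilon>) (x +o U) \<subseteq> smulC \<alpha> ` G))))"
  by (intro conjI impI topological_evs.ex_local_base)

end
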